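(* Let $(\mathcal{T},\Gamma)$ be a completely $0$-simple $\Gamma$-semigroup. Then the non-zero elements of $\mathcal{T}$ form a $\mathcal{D}$-class of $(\mathcal{T},\Gamma)$, and $(\mathcal{T},\Gamma)$ is $\Gamma$-regular, i.e. every element of $\mathcal{T}$ is regular.
   Context: A $\Gamma$-semigroup $(\mathcal{T},\Gamma)$ consists of non-empty sets $\mathcal{T},\Gamma$ and a map $\mathcal{T}\times\Gamma\times\mathcal{T}\to\mathcal{T}$, $(e,\alpha,f)\mapsto [e\alpha f]=e\alpha f$, with $(e\alpha f)\beta g=e\alpha(f\beta g)$ for all $e,f,g\in\mathcal{T}$, $\alpha,\beta\in\Gamma$. For $A,B\subseteq\mathcal{T}$ put $[A\Gamma B]=\{a\gamma b: a\in A,\gamma\in\Gamma,b\in B\}$, writing $a$ for $\{a\}$. A zero is an element $0\in\mathcal{T}$ with $e\gamma 0=0\gamma e=0$ for all $e\in\mathcal{T},\gamma\in\Gamma$. A $\Gamma$-2-sided ideal is a non-empty $B\subseteq\mathcal{T}$ with $[\mathcal{T}\Gamma B]\subseteq B$ and $[B\Gamma\mathcal{T}]\subseteq B$. A $\Gamma$-semigroup with zero is $0$-simple if $[\mathcal{T}\Gamma\mathcal{T}]\neq\{0\}$ and its only $\Gamma$-2-sided ideals are $\{0\}$ and $\mathcal{T}$. An element $e\in\mathcal{T}$ is an idempotent if $[e\alpha e]=e$ for some $\alpha\in\Gamma$. For idempotents $e,f$, the order $e\le f$ is defined to mean that there exist $x,y\in\Gamma$ with $[exf]=[fye]=e$.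 An idempotent is primitive if it is non-zero and is minimal, with respect to $\le$, in the set of non-zero idempotents. A $0$-simple $\Gamma$-semigroup is completely $0$-simple if it contains a primitive idempotent. An element $a\in\mathcal{T}$ is regular if there is an $\alpha\in\Gamma$ with $[a\alpha a]=a$. Green's relations: $e\,\mathcal{L}\,f$ iff $[\mathcal{T}\Gamma e]\cup\{e\}=[\mathcal{T}\Gamma f]\cup\{f\}$; $e\,\mathcal{R}\,f$ iff $[e\Gamma\mathcal{T}]\cup\{e\}=[f\Gamma\mathcal{T}]\cup\{f\}$; $\mathcal{D}=\mathcal{L}\circ\mathcal{R}$, i.e. $e\,\mathcal{D}\,f$ iff there is $c\in\mathcal{T}$ with $e\,\mathcal{L}\,c$ and $c\,\mathcal{R}\,f$.
   Formalization: "Regular" is read as: there are α,β in Γ and x in T with aαxβa = a. The stated condition [aαa] = a only says a is idempotent, and the claim then fails: in {0,1,-1} under multiplication with one-element Γ, (-1)(-1) = 1. *)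

theory Defs
  imports Main
begin

locale gamma_semigroup =
  fixes T :: "'a set" and G :: "'g set" and m :: "'a \<Rightarrow> 'g \<Rightarrow> 'a \<Rightarrow> 'a"
  assumes T_nonempty: "T \<noteq> {}"
    and G_nonempty: "G \<noteq> {}"
    and m_closed: "\<lbrakk>e \<in> T; \<alpha> \<in> G; f \<in> T\<rbrakk> \<Longrightarrow> m e \<alpha> f \<in> T"
    and m_assoc: "\<lbrakk>e \<in> T; \<alpha> \<in> G; f \<in> T; \<beta> \<in> G; g \<in> T\<rbrakk>
                    \<Longrightarrow> m (m e \<alpha> f) \<beta> g = m e \<alpha> (m f \<beta> g)"
begin

definition set_mult :: "'a set \<Rightarrow> 'a set \<Rightarrow> 'a set" where
  "set_mult A B = {m a \<gamma> b | a \<gamma> b. a \<in> A \<and> \<gamma> \<in> G \<and> b \<in> B}"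

definition two_sided_ideal :: "'a set \<Rightarrow> bool" where
  "two_sided_ideal B \<longleftrightarrow> B \<noteq> {} \<and> B \<subseteq> T \<and> set_mult T B \<subseteq> B \<and> set_mult B T \<subseteq> B"

definition idempotent :: "'a \<Rightarrow> bool" where
  "idempotent e \<longleftrightarrow> e \<in> T \<and> (\<exists>\<alpha>\<in>G. m e \<alpha> e = e)"

definition idem_le :: "'a \<Rightarrow> 'a \<Rightarrow> bool" where
  "idem_le e f \<longleftrightarrow> (\<exists>x\<in>G. \<exists>y\<in>G. m e x f = e \<and> m f y e = e)"

(* a \<in> a \<Gamma> T \<Gamma> a, the usual regularity in a \<Gamma>-semigroup.  The condition
   "m a \<alpha> a = a for some \<alpha> \<in> G" is sometimes found instead, but it is the
   definition of an idempotent; see the lemma group_with_zero_example below. *)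
definition regular :: "'a \<Rightarrow> bool" where
  "regular a \<longleftrightarrow> a \<in> T \<and> (\<exists>\<alpha>\<in>G. \<exists>x\<in>T. \<exists>\<beta>\<in>G. m (m a \<alpha> x) \<beta> a = a)"

definition gamma_regular :: bool where
  "gamma_regular \<longleftrightarrow> (\<forall>a\<in>T. regular a)"

definition green_L :: "'a rel" where
  "green_L = {(e, f). e \<in> T \<and> f \<in> T \<and> set_mult T {e} \<union> {e} = set_mult T {f} \<union> {f}}"

definition green_R :: "'a rel" where
  "green_R = {(e, f). e \<in> T \<and> f \<in> T \<and> set_mult {e} T \<union> {e} = set_mult {f} T \<union> {f}}"

definition green_D :: "'a rel" where
  "green_D = green_L O green_R"

end

locale gamma_semigroup_zero = gamma_semigroup T G m
  for T :: "'a set" and G :: "'g set" and m :: "'a \<Rightarrow> 'g \<Rightarrow> 'a \<Rightarrow> 'a" +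
  fixes z :: 'a
  assumes zero_closed: "z \<in> T"
    and zero_right: "\<lbrakk>e \<in> T; \<gamma> \<in> G\<rbrakk> \<Longrightarrow> m e \<gamma> z = z"
    and zero_left: "\<lbrakk>e \<in> T; \<gamma> \<in> G\<rbrakk> \<Longrightarrow> m z \<gamma> e = z"
begin

(* idem_le is reflexive and transitive on idempotents but need not be antisymmetric
   (in a group H viewed as a \<Gamma>-semigroup with \<Gamma> = H, any two elements are comparable),
   so minimality is minimality in a preorder.  An idempotent e for which
   idem_le f e implies f = e is in particular primitive in this sense. *)
definition primitive :: "'a \<Rightarrow> bool" where
  "primitive e \<longleftrightarrow> idempotent e \<and> e \<noteq> z \<and>
     (\<forall>f. idempotent f \<and> f \<noteq> z \<and> idem_le f e \<longrightarrow> idem_le e f)"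

end

locale zero_simple_gamma_semigroup = gamma_semigroup_zero +
  assumes product_nonzero: "set_mult T T \<noteq> {z}"
    and ideals: "two_sided_ideal B \<Longrightarrow> B = {z} \<or> B = T"

locale completely_zero_simple_gamma_semigroup = zero_simple_gamma_semigroup +
  assumes primitive_exists: "\<exists>e. primitive e"

(* In the two-element group with zero {0, 1, -1}, with \<Gamma> a singleton, -1 is not an
   idempotent.  So a completely 0-simple \<Gamma>-semigroup need not satisfy
   "for every a there is \<alpha> \<in> G with m a \<alpha> a = a". *)
lemma group_with_zero_example:
  defines "T \<equiv> {0, 1, - 1 :: int}" and "G \<equiv> {()}" and "m \<equiv> (\<lambda>a (_::unit) b. a * b)"
  shows "completely_zero_simple_gamma_semigroup T G m 0"
    and "\<not> (\<forall>a\<in>T. \<exists>\<alpha>\<in>G. m a \<alpha> a = a)"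
proof -
  interpret gamma_semigroup_zero T G m 0
    by unfold_locales (auto simp: T_def G_def m_def)
  have sm: "set_mult A B = {a * b | a b. a \<in> A \<and> b \<in> B}" for A B
    unfolding set_mult_def by (auto simp: G_def m_def)
  have ideal: "B = {0} \<or> B = T" if "two_sided_ideal B" for B
  proof -
    have B: "B \<noteq> {}" "B \<subseteq> T" and cl: "\<And>a b. a \<in> T \<Longrightarrow> b \<in> B \<Longrightarrow> a * b \<in> B"
      using that unfolding two_sided_ideal_def sm by blast+
    obtain b where b: "b \<in> B" using B by blast
    have 0: "0 \<in> B" using cl[of 0 b] b by (simp add: T_def)
    show ?thesis
    proof (cases "B = {0}")
      case False
      then obtain c where "c \<in> B" "c = 1 \<or> c = - 1" using 0 B by (auto simp: T_def)
      then have "1 \<in> B" "- 1 \<in> B"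
        using cl[of 1 c] cl[of "- 1" c] by (auto simp: T_def)
      then show ?thesis using 0 B by (auto simp: T_def)
    qed simp
  qed
  have "1 \<in> set_mult T T" unfolding sm T_def by force
  moreover have "primitive 1"
    unfolding primitive_def idempotent_def idem_le_def
    by (auto simp: T_def G_def m_def)
  ultimately show "completely_zero_simple_gamma_semigroup T G m 0"
    by unfold_locales (use ideal in auto)
  show "\<not> (\<forall>a\<in>T. \<exists>\<alpha>\<in>G. m a \<alpha> a = a)"
    by (simp add: T_def G_def m_def)
qed

end

theory Submission
  imports Defs
begin

text \<open>
  Let \<open>e\<close> be a primitive idempotent. By 0-simplicity every non-zero element \<open>a\<close> satisfies
  \<open>T\<Gamma>a\<Gamma>T = T\<close>. Hence if \<open>a \<in> e\<Gamma>T\<close> is non-zero, one can write \<open>e\<close> as \<open>u a v\<close> with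
  \<open>u \<in> e\<Gamma>T\<Gamma>e\<close>; then \<open>a v u\<close> is a non-zero idempotent below \<open>e\<close>, so primitivity gives
  \<open>e \<in> a\<Gamma>T\<close>. Together with the dual statement for \<open>T\<Gamma>e\<close>, every non-zero
  \<open>b = u e v\<close> satisfies \<open>e \<L> u e \<R> b\<close>; cancelling \<open>u\<close> and \<open>v\<close> also exhibits an inner inverse
  of \<open>b\<close>.
\<close>

context gamma_semigroup
begin

lemma set_multI: "a \<in> A \<Longrightarrow> \<gamma> \<in> G \<Longrightarrow> b \<in> B \<Longrightarrow> m a \<gamma> b \<in> set_mult A B"
  unfolding set_mult_def by blast

lemma set_multE:
  assumes "c \<in> set_mult A B"
  obtains a \<gamma> b where "a \<in> A" "\<gamma> \<in> G" "b \<in> B" "c = m a \<gamma> b"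
  using assms unfolding set_mult_def by blast

lemma two_sided_idealI:
  assumes "B \<noteq> {}" "B \<subseteq> T"
    and "\<And>t \<gamma> b. \<lbrakk>t \<in> T; \<gamma> \<in> G; b \<in> B\<rbrakk> \<Longrightarrow> m t \<gamma> b \<in> B"
    and "\<And>t \<gamma> b. \<lbrakk>t \<in> T; \<gamma> \<in> G; b \<in> B\<rbrakk> \<Longrightarrow> m b \<gamma> t \<in> B"
  shows "two_sided_ideal B"
  using assms unfolding two_sided_ideal_def set_mult_def by blast

lemma left_ideal_subset:
  assumes "a \<in> T" "b \<in> T" "\<gamma> \<in> G"
  shows "set_mult T {m a \<gamma> b} \<union> {m a \<gamma> b} \<subseteq> set_mult T {b} \<union> {b}"
  using assms set_multI[of _ T \<gamma> b "{b}"]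
  by (intro le_supI1) (auto elim!: set_multE simp: m_assoc[symmetric] m_closed)

lemma right_ideal_subset:
  assumes "a \<in> T" "b \<in> T" "\<gamma> \<in> G"
  shows "set_mult {m a \<gamma> b} T \<union> {m a \<gamma> b} \<subseteq> set_mult {a} T \<union> {a}"
  using assms set_multI[of a "{a}" \<gamma> _ T]
  by (intro le_supI1) (auto elim!: set_multE simp: m_assoc m_closed)

text \<open>Each divisibility puts one principal left ideal inside the other, so L can be checked by
  exhibiting multipliers.\<close>

lemma green_LI:
  assumes "a \<in> T" "b \<in> T" "p \<in> T" "q \<in> T" "\<gamma> \<in> G" "\<delta> \<in> G" "a = m p \<gamma> b" "b = m q \<delta> a"
  shows "(a, b) \<in> green_L"
  using left_ideal_subset[OF assms(3,2,5)] left_ideal_subset[OF assms(4,1,6)] assms(1,2)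
  unfolding green_L_def assms(7,8)[symmetric] by blast

lemma green_RI:
  assumes "a \<in> T" "b \<in> T" "p \<in> T" "q \<in> T" "\<gamma> \<in> G" "\<delta> \<in> G" "a = m b \<gamma> p" "b = m a \<delta> q"
  shows "(a, b) \<in> green_R"
  using right_ideal_subset[OF assms(2,3,5)] right_ideal_subset[OF assms(1,4,6)] assms(1,2)
  unfolding green_R_def assms(7,8)[symmetric] by blast

text \<open>Reversing the product exchanges left and right, so that one-sided results can be
  dualised instead of proved twice.\<close>

lemma opposite_gamma_semigroup: "gamma_semigroup T G (\<lambda>a \<gamma> b. m b \<gamma> a)"
  by unfold_locales (use T_nonempty G_nonempty in \<open>auto simp: m_closed m_assoc\<close>)

end

context gamma_semigroup_zero
begin

text \<open>The principal one-sided ideals of \<open>z\<close> reduce to {z}; this keeps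
  \<open>z\<close> out of the D-class of a non-zero element.\<close>

lemma green_L_zero: "(e, z) \<in> green_L \<Longrightarrow> e = z"
  unfolding green_L_def set_mult_def using zero_right by auto

lemma green_R_zero: "(e, z) \<in> green_R \<Longrightarrow> e = z"
  unfolding green_R_def set_mult_def using zero_left by auto

lemma green_D_zero: "(e, z) \<in> green_D \<Longrightarrow> e = z"
  unfolding green_D_def using green_L_zero green_R_zero by blast

end

context zero_simple_gamma_semigroup
begin

lemma set_mult_T_T: "set_mult T T = T"
proof -
  have "two_sided_ideal (set_mult T T)"
  proof (rule two_sided_idealI)
    show "set_mult T T \<noteq> {}"
      using T_nonempty G_nonempty set_multI[of _ T _ _ T] by blast
  qed (auto elim!: set_multE intro!: set_multI m_closed)
  then show ?thesis using ideals product_nonzero by blast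
qed

lemma factorE:
  assumes "t \<in> T"
  obtains p \<gamma> q where "p \<in> T" "\<gamma> \<in> G" "q \<in> T" "t = m p \<gamma> q"
  using assms set_mult_T_T by (metis set_multE)

lemma sandwich_nonzero:
  assumes "a \<in> T" "a \<noteq> z"
  obtains p \<gamma> \<delta> q where "p \<in> T" "\<gamma> \<in> G" "\<delta> \<in> G" "q \<in> T" "m p \<gamma> (m a \<delta> q) \<noteq> z"
proof (rule ccontr)
  assume "\<not> thesis"
  note none = this
  \<comment> \<open>The elements annihilated by all two-sided products form an ideal; a non-zero
    member \<open>a\<close> forces it to be all of \<open>T\<close>.\<close>
  define N where "N = {b \<in> T. \<forall>p\<in>T. \<forall>\<gamma>\<in>G. \<forall>\<delta>\<in>G. \<forall>q\<in>T. m p \<gamma> (m b \<delta> q) = z}"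
  have a: "a \<in> N" using none that assms unfolding N_def by blast
  have "two_sided_ideal N"
  proof (rule two_sided_idealI)
    fix t \<gamma> b assume t: "t \<in> T" "\<gamma> \<in> G" "b \<in> N"
    then have b: "b \<in> T"
      and ann: "\<And>p \<gamma> \<delta> q. \<lbrakk>p \<in> T; \<gamma> \<in> G; \<delta> \<in> G; q \<in> T\<rbrakk> \<Longrightarrow> m p \<gamma> (m b \<delta> q) = z"
      unfolding N_def by auto
    \<comment> \<open>Reassociating turns the outer factor \<open>t\<close> into part of the left
      multiplier here, and of the right multiplier in the next case.\<close>
    show "m t \<gamma> b \<in> N" unfolding N_def using t b ann
      by (auto simp: m_closed m_assoc zero_right)
    show "m b \<gamma> t \<in> N" unfolding N_def using t b ann
      by (auto simp: m_closed m_assoc zero_right)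
  qed (use a in \<open>auto simp: N_def\<close>)
  then have N: "N = T" using ideals[of N] a assms by blast
  \<comment> \<open>Factoring twice gives t = p s q, whose middle factor lies in \<open>N\<close>,
    so all of \<open>T\<close> would collapse to \<open>z\<close>.\<close>
  have "t = z" if t: "t \<in> T" for t
  proof -
    obtain p \<gamma> r where 1: "p \<in> T" "\<gamma> \<in> G" "r \<in> T" "t = m p \<gamma> r" using factorE t by metis
    obtain s \<delta> q where 2: "s \<in> T" "\<delta> \<in> G" "q \<in> T" "r = m s \<delta> q" using factorE 1(3) by metis
    have "s \<in> N" using 2(1) N by simp
    then show "t = z" using 1 2 unfolding N_def by auto
  qed
  then show False using assms by blast
qed

text \<open>The products p a q form an ideal, which is not {z} by \<open>sandwich_nonzero\<close>
  and therefore equals \<open>T\<close>.\<close>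

lemma sandwichE:
  assumes "a \<in> T" "a \<noteq> z" "t \<in> T"
  obtains p \<gamma> \<delta> q where "p \<in> T" "\<gamma> \<in> G" "\<delta> \<in> G" "q \<in> T" "t = m p \<gamma> (m a \<delta> q)"
proof -
  define J where "J = {m p \<gamma> (m a \<delta> q) | p \<gamma> \<delta> q. p \<in> T \<and> \<gamma> \<in> G \<and> \<delta> \<in> G \<and> q \<in> T}"
  obtain p \<gamma> \<delta> q where nz: "p \<in> T" "\<gamma> \<in> G" "\<delta> \<in> G" "q \<in> T" "m p \<gamma> (m a \<delta> q) \<noteq> z"
    using sandwich_nonzero[OF assms(1,2)] by metis
  then have J: "m p \<gamma> (m a \<delta> q) \<in> J" unfolding J_def by blast
  have "two_sided_ideal J"
  proof (rule two_sided_idealI)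
    fix t \<epsilon> b assume t: "t \<in> T" "\<epsilon> \<in> G" "b \<in> J"
    then obtain p \<gamma> \<delta> q where b: "p \<in> T" "\<gamma> \<in> G" "\<delta> \<in> G" "q \<in> T" "b = m p \<gamma> (m a \<delta> q)"
      unfolding J_def by blast
    have "m t \<epsilon> b = m (m t \<epsilon> p) \<gamma> (m a \<delta> q)" "m b \<epsilon> t = m p \<gamma> (m a \<delta> (m q \<epsilon> t))"
      using b t assms by (simp_all add: m_closed m_assoc)
    then show "m t \<epsilon> b \<in> J" "m b \<epsilon> t \<in> J"
      unfolding J_def using b t m_closed by blast+
  next
    show "J \<noteq> {}" using J by blast
    show "J \<subseteq> T" unfolding J_def using assms m_closed by blast
  qed
  then have "J = T" using ideals[of J] J nz by blast
  then show thesis using that assms(3) unfolding J_def by blast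
qed

text \<open>In other words, the right ideal generated by \<open>e\<close> is 0-minimal: each of its
  non-zero elements a = e t generates \<open>e\<close> again.\<close>

lemma primitive_right_minimal:
  assumes e: "primitive e" and t: "t \<in> T" "\<gamma> \<in> G" and nz: "m e \<gamma> t \<noteq> z"
  obtains \<delta> w where "\<delta> \<in> G" "w \<in> T" "e = m (m e \<gamma> t) \<delta> w"
proof -
  obtain \<alpha> where \<alpha>: "e \<in> T" "\<alpha> \<in> G" "m e \<alpha> e = e" and ez: "e \<noteq> z"
    using e unfolding primitive_def idempotent_def by blast
  define a where "a = m e \<gamma> t"
  have a: "a \<in> T" "a \<noteq> z" "m e \<alpha> a = a"
    unfolding a_def using \<alpha> t nz by (auto simp: m_closed m_assoc[symmetric])
  obtain p \<mu> \<nu> v where p: "p \<in> T" "\<mu> \<in> G" "\<nu> \<in> G" "v \<in> T" "e = m p \<mu> (m a \<nu> v)"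
    using sandwichE[OF a(1,2) \<alpha>(1)] by metis
  \<comment> \<open>Compressing \<open>p\<close> between two copies of \<open>e\<close> makes
    \<open>e\<close> an identity for \<open>u\<close> on both sides with respect to
    \<open>\<alpha>\<close>, while u a v = e still holds.\<close>
  define u where "u = m e \<alpha> (m p \<mu> e)"
  have u: "u \<in> T" "m u \<alpha> e = u" "m e \<alpha> u = u"
    unfolding u_def using \<alpha> p
    by (simp_all add: m_closed m_assoc) (simp add: m_closed m_assoc[symmetric])
  have "m u \<alpha> (m a \<nu> v) = m e \<alpha> (m p \<mu> (m (m e \<alpha> a) \<nu> v))"
    unfolding u_def using \<alpha>(1,2) p(1-4) a(1) by (simp add: m_closed m_assoc)
  then have uav: "m u \<alpha> (m a \<nu> v) = e" using a(3) \<alpha>(3) by (simp flip: p(5))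
  \<comment> \<open>Rotating u a v = e gives f = a v u, with f f = a v (u a v) u = a v e u =
    f.\<close>
  define f where "f = m a \<nu> (m v \<alpha> u)"
  have f: "f \<in> T" unfolding f_def using a u p \<alpha> by (simp add: m_closed)
  have "m f \<alpha> f = m a \<nu> (m v \<alpha> (m (m u \<alpha> (m a \<nu> v)) \<alpha> u))"
    unfolding f_def using a(1) u(1) p(1-4) \<alpha>(1,2) by (simp add: m_closed m_assoc)
  then have ff: "m f \<alpha> f = f" using uav u(3) f_def by simp
  have fe: "m f \<alpha> e = f"
    unfolding f_def using a(1) u p(1-4) \<alpha>(1,2) by (simp add: m_closed m_assoc)
  have ef: "m e \<alpha> f = f"
    unfolding f_def using a u(1) p(1-4) \<alpha>(1,2) by (simp add: m_closed m_assoc[symmetric])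
  \<comment> \<open>Here u f (a v) = (u a v)(u a v) = e, so \<open>f\<close> cannot be
    \<open>z\<close>.\<close>
  have "m u \<alpha> (m f \<alpha> (m a \<nu> v)) = m (m u \<alpha> (m a \<nu> v)) \<alpha> (m u \<alpha> (m a \<nu> v))"
    unfolding f_def using a(1) u(1) p(1-4) \<alpha>(1,2) by (simp add: m_closed m_assoc)
  then have "m u \<alpha> (m f \<alpha> (m a \<nu> v)) = e" using uav \<alpha>(3) by simp
  then have "f \<noteq> z"
    using ez a(1) u(1) p(3,4) \<alpha>(2) by (auto simp: m_closed zero_left zero_right)
  moreover have "idempotent f" "idem_le f e"
    unfolding idempotent_def idem_le_def using f ff fe ef \<alpha>(2) by blast+
  \<comment> \<open>Minimality in a preorder yields e below f rather than f = e. That suffices: e =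
    f y e begins with \<open>a\<close>.\<close>
  ultimately have "idem_le e f" using e unfolding primitive_def by blast
  then obtain y where y: "y \<in> G" "m f y e = e" unfolding idem_le_def by blast
  have "e = m a \<nu> (m (m v \<alpha> u) y e)"
    using y a(1) u(1) p(3,4) \<alpha>(1,2) unfolding f_def by (simp add: m_closed m_assoc)
  then show thesis
    using that[of \<nu> "m (m v \<alpha> u) y e"] y(1) u(1) p(3,4) \<alpha>(1,2) unfolding a_def
    by (simp add: m_closed)
qed

lemma opposite_zero_simple: "zero_simple_gamma_semigroup T G (\<lambda>a \<gamma> b. m b \<gamma> a) z"
proof -
  interpret op: gamma_semigroup T G "\<lambda>a \<gamma> b. m b \<gamma> a" by (rule opposite_gamma_semigroup)
  have sm: "op.set_mult A B = set_mult B A" for A B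
    unfolding op.set_mult_def set_mult_def by blast
  have "op.two_sided_ideal B = two_sided_ideal B" for B
    unfolding op.two_sided_ideal_def two_sided_ideal_def sm by blast
  then show ?thesis
    using product_nonzero ideals
    by unfold_locales (simp_all add: zero_closed zero_left zero_right sm)
qed

lemma primitive_left_minimal:
  assumes e: "primitive e" and t: "t \<in> T" "\<gamma> \<in> G" and nz: "m t \<gamma> e \<noteq> z"
  obtains \<delta> w where "\<delta> \<in> G" "w \<in> T" "e = m w \<delta> (m t \<gamma> e)"
proof -
  interpret op: zero_simple_gamma_semigroup T G "\<lambda>a \<gamma> b. m b \<gamma> a" z
    by (rule opposite_zero_simple)
  \<comment> \<open>Reversal merely swaps the two equations in \<open>idem_le\<close>, so both
    structures have the same primitive idempotents.\<close>
  have "op.idempotent = idempotent" "op.idem_le = idem_le"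
    unfolding op.idempotent_def idempotent_def op.idem_le_def idem_le_def by (intro ext; blast)+
  then have "op.primitive e" using e unfolding op.primitive_def primitive_def by simp
  then show thesis using op.primitive_right_minimal[of e t \<gamma>] t nz that by metis
qed

lemma primitive_D_and_regular:
  assumes e: "primitive e" and b: "b \<in> T" "b \<noteq> z"
  shows "(e, b) \<in> green_D" and "regular b"
proof -
  obtain \<alpha> where \<alpha>: "e \<in> T" "\<alpha> \<in> G" "m e \<alpha> e = e" and ez: "e \<noteq> z"
    using e unfolding primitive_def idempotent_def by blast
  obtain u \<mu> \<nu> v where u: "u \<in> T" "\<mu> \<in> G" "\<nu> \<in> G" "v \<in> T" "b = m u \<mu> (m e \<nu> v)"
    using sandwichE[OF \<alpha>(1) ez b(1)] by metis
  \<comment> \<open>This is the element linking \<open>e\<close> to \<open>b\<close>: cancelling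
    \<open>u\<close> on the left recovers \<open>e\<close> from \<open>c\<close>, and cancelling
    \<open>v\<close> on the right recovers \<open>c\<close> from \<open>b\<close>.\<close>
  define c where "c = m u \<mu> e"
  have c: "c \<in> T" "b = m c \<nu> v"
    unfolding c_def using u \<alpha> by (auto simp: m_closed m_assoc)
  then have "m u \<mu> e \<noteq> z" using b(2) zero_left[OF u(4,3)] unfolding c_def by metis
  then obtain \<sigma> p where p: "\<sigma> \<in> G" "p \<in> T" "e = m p \<sigma> c"
    using primitive_left_minimal[OF e u(1,2)] unfolding c_def by metis
  have "m e \<nu> v \<noteq> z" using b(2) u(5) zero_right[OF u(1,2)] by metis
  then obtain \<delta> w where w: "\<delta> \<in> G" "w \<in> T" "e = m (m e \<nu> v) \<delta> w"
    using primitive_right_minimal[OF e u(4,3)] by metis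
  have "m b \<delta> w = m u \<mu> (m (m e \<nu> v) \<delta> w)"
    using u \<alpha>(1) w(1,2) by (simp add: m_closed m_assoc)
  then have cb: "c = m b \<delta> w" unfolding c_def by (simp flip: w(3))
  have "(e, c) \<in> green_L"
    using green_LI[OF \<alpha>(1) c(1) p(2) u(1) p(1) u(2) p(3) c_def] .
  moreover have "(c, b) \<in> green_R"
    using green_RI[OF c(1) b(1) w(2) u(4) w(1) u(3) cb c(2)] .
  ultimately show "(e, b) \<in> green_D" unfolding green_D_def by blast
  \<comment> \<open>Substituting e = p c and c = b w into b = (c e) v gives b = b (w p) b, so the
    inner inverse is \<open>m w \<alpha> p\<close>, an element of \<open>T\<close> with a letter of
    \<open>G\<close> on each side.\<close>
  have "m c \<alpha> e = c" unfolding c_def using u \<alpha> by (simp add: m_assoc)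
  then have "b = m (m c \<alpha> (m p \<sigma> c)) \<nu> v" using c p(3) by simp
  also have "\<dots> = m (m c \<alpha> p) \<sigma> (m c \<nu> v)"
    using c(1) p(1,2) u(3,4) \<alpha>(2) by (simp add: m_closed m_assoc)
  also have "\<dots> = m (m (m b \<delta> w) \<alpha> p) \<sigma> b" by (simp flip: cb c(2))
  also have "\<dots> = m (m b \<delta> (m w \<alpha> p)) \<sigma> b"
    using b(1) w(1,2) p(1,2) \<alpha>(2) by (simp add: m_assoc)
  finally show "regular b"
    unfolding regular_def using b(1) w(1,2) p(1,2) \<alpha>(2) m_closed by metis
qed

end

theorem theorem5p1:
  fixes T :: "'a set" and G :: "'g set" and m :: "'a \<Rightarrow> 'g \<Rightarrow> 'a \<Rightarrow> 'a" and z :: 'a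
  assumes "completely_zero_simple_gamma_semigroup T G m z"
  shows "T - {z} \<in> T // gamma_semigroup.green_D T G m \<and>
         gamma_semigroup.gamma_regular T G m"
proof -
  interpret completely_zero_simple_gamma_semigroup T G m z by (rule assms)
  obtain e where e: "primitive e" using primitive_exists by blast
  then have eT: "e \<in> T" "e \<noteq> z" unfolding primitive_def idempotent_def by blast+
  have "green_D `` {e} = T - {z}"
    using primitive_D_and_regular(1)[OF e] green_D_zero[of e] eT
    unfolding green_D_def green_R_def by blast
  then have "T - {z} \<in> T // green_D" using quotientI[OF eT(1), of green_D] by simp
  \<comment> \<open>\<open>primitive_D_and_regular\<close> covers only non-zero elements.\<close>
  moreover have "regular z"
  proof -
    obtain \<gamma> where "\<gamma> \<in> G" using G_nonempty by blast
    then have "m (m z \<gamma> z) \<gamma> z = z" by (simp add: zero_closed zero_left)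
    then show ?thesis unfolding regular_def using \<open>\<gamma> \<in> G\<close> zero_closed by blast
  qed
  ultimately show ?thesis
    using primitive_D_and_regular(2)[OF e] unfolding gamma_regular_def by blast
qed

end
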